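(* Let $n,d,T\ge1$ be integers. Let $f_1,\dots,f_n:\mathbb{R}^d\to\mathbb{R}$ be continuously differentiable and let $L_1>0$ be such that $\|\nabla f_i(x)-\nabla f_i(y)\|_\infty\le L_1\|x-y\|_1$ for all $i\in\{1,\dots,n\}$ and $x,y\in\mathbb{R}^d$. Let $f=\frac1n\sum_{i=1}^nf_i$ and assume that $f$ is bounded below. Fix $\mathsf P>0$ and set $$D=\mathsf P\sqrt{\frac{2}{L_1T}},\qquad\gamma=\frac1d\sqrt{\frac2{L_1T}}.$$ Then, for both Variant 1 and Variant 2 of the algorithm SignSVRG (see context) run with parameters $L_1,D,\gamma$, the number $k(T)$ of reference points used up to time $T$ satisfies $k(T)\le\lceil T/\mathsf P\rceil$.
   Context: $\|\cdot\|_1,\|\cdot\|_\infty$ are the $\ell_1$- and $\ell_\infty$-norms on $\mathbb{R}^d$; $u^j$ is the $j$-th coordinate of $u$; $u\otimes v$ is the coordinate-wise product; $\mathrm{sign}$ acts coordinate-wise with $\mathrm{sign}(0)=0$. SignSVRG algorithm (with $q=1$, $p=\infty$). Input: deterministic $x_1\in\mathbb{R}^d$, $L_1,D,\gamma>0$. Set $k(1)=1$, $\tilde x_1=x_1$ (initial reference point), $g_1=\nabla f(x_1)$. For $t=1,\dots,T$: 1. Sample $i_t$ uniformly on $\{1,\dots,n\}$ and $U_t$ uniformly on $[-1,1]^d$, independent of each other and of the past. 2. Define $G_t\in\mathbb{R}^d$ by, for every $j\in\{1,\dots,d\}$: Variant 1: $G_t^j=L_1\|x_t-\tilde x_{k(t)}\|_1+\|g_{k(t)}\|_\infty$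 (the same value for all $j$); Variant 2: $G_t^j=L_1\|x_t-\tilde x_{k(t)}\|_1+|g_{k(t)}^j|$. 3. Set $x_t^+=x_t-\gamma\,\mathrm{sign}\big(\nabla f_{i_t}(x_t)-\nabla f_{i_t}(\tilde x_{k(t)})+g_{k(t)}+G_t\otimes U_t\big)$ and $x_{t+1}=x_t^+$. 4. If $\|x_t^+-\tilde x_{k(t)}\|_1\le D$, keep the reference point: $k(t+1)=k(t)$. Otherwise update it: $k(t+1)=k(t)+1$, $\tilde x_{k(t+1)}=x_t^+$, $g_{k(t+1)}=\nabla f(x_t^+)$. Thus $k(t)$ is the number of reference points (including the initial one) up to time $t$. *)

theory Defs
  imports "HOL-Probability.Probability"
begin

definition gradient :: "('a::real_inner \<Rightarrow> real) \<Rightarrow> 'a \<Rightarrow> 'a" where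
  "gradient f x = (THE D. GDERIV f x :> D)"

definition continuously_differentiable :: "('a::real_inner \<Rightarrow> real) \<Rightarrow> bool" where
  "continuously_differentiable f \<longleftrightarrow>
     (\<forall>x. GDERIV f x :> gradient f x) \<and> continuous_on UNIV (gradient f)"

text \<open>The library norm on \<^typ>\<open>real ^ 'd\<close> is the Euclidean one; the sup-norm is \<^const>\<open>infnorm\<close>.\<close>

definition l1_norm :: "real ^ 'd \<Rightarrow> real" where
  "l1_norm u = (\<Sum>j\<in>UNIV. \<bar>u $ j\<bar>)"

definition sign_vec :: "real ^ 'd \<Rightarrow> real ^ 'd" where
  "sign_vec u = (\<chi> j. sgn (u $ j))"

definition average_fun :: "nat \<Rightarrow> (nat \<Rightarrow> 'a \<Rightarrow> real) \<Rightarrow> 'a \<Rightarrow> real" where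
  "average_fun n f x = (1 / real n) * (\<Sum>i = 1..n. f i x)"

datatype variant = Variant1 | Variant2

record 'v svrg_state =
  iterate :: 'v
  ref_point :: 'v
  ref_gradient :: 'v
  ref_count :: nat

definition noise_scale ::
  "variant \<Rightarrow> real \<Rightarrow> (real ^ 'd) svrg_state \<Rightarrow> real ^ 'd" where
  "noise_scale v L1 s =
     (\<chi> j. L1 * l1_norm (iterate s - ref_point s) +
        (case v of Variant1 \<Rightarrow> infnorm (ref_gradient s) | Variant2 \<Rightarrow> \<bar>ref_gradient s $ j\<bar>))"

definition svrg_init ::
  "nat \<Rightarrow> (nat \<Rightarrow> real ^ 'd \<Rightarrow> real) \<Rightarrow> real ^ 'd \<Rightarrow> (real ^ 'd) svrg_state" where
  "svrg_init n f x1 =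
     \<lparr>iterate = x1, ref_point = x1, ref_gradient = gradient (average_fun n f) x1, ref_count = 1\<rparr>"

text \<open>Multiplication on \<^typ>\<open>real ^ 'd\<close> is coordinate-wise.\<close>

definition svrg_step ::
  "variant \<Rightarrow> nat \<Rightarrow> (nat \<Rightarrow> real ^ 'd \<Rightarrow> real) \<Rightarrow> real \<Rightarrow> real \<Rightarrow> real
    \<Rightarrow> nat \<Rightarrow> real ^ 'd \<Rightarrow> (real ^ 'd) svrg_state \<Rightarrow> (real ^ 'd) svrg_state" where
  "svrg_step v n f L1 D \<gamma> i u s =
     (let x' = iterate s - \<gamma> *\<^sub>R
            sign_vec (gradient (f i) (iterate s) - gradient (f i) (ref_point s)
              + ref_gradient s + noise_scale v L1 s * u)
      in if l1_norm (x' - ref_point s) \<le> D then s\<lparr>iterate := x'\<rparr>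
         else \<lparr>iterate = x', ref_point = x',
               ref_gradient = gradient (average_fun n f) x', ref_count = ref_count s + 1\<rparr>)"

text \<open>State at time \<open>t\<close> along one realization \<open>i\<close>, \<open>u\<close> of the samples. Time starts
  at 1; the value at 0 is a dummy equal to the initial state.\<close>

primrec sign_svrg ::
  "variant \<Rightarrow> nat \<Rightarrow> (nat \<Rightarrow> real ^ 'd \<Rightarrow> real) \<Rightarrow> real \<Rightarrow> real \<Rightarrow> real \<Rightarrow> real ^ 'd
    \<Rightarrow> (nat \<Rightarrow> nat) \<Rightarrow> (nat \<Rightarrow> real ^ 'd) \<Rightarrow> nat \<Rightarrow> (real ^ 'd) svrg_state" where
  "sign_svrg v n f L1 D \<gamma> x1 i u 0 = svrg_init n f x1"
| "sign_svrg v n f L1 D \<gamma> x1 i u (Suc t) =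
     (if t = 0 then svrg_init n f x1
      else svrg_step v n f L1 D \<gamma> (i t) (u t) (sign_svrg v n f L1 D \<gamma> x1 i u t))"

text \<open>The first independence condition says that the pair sampled at each step is independent
  of the past pairs; the second, in terms of generated sigma-algebras because
  the two components have different types, that they are independent of each other.\<close>

definition svrg_sampling ::
  "'w measure \<Rightarrow> nat \<Rightarrow> nat \<Rightarrow> (nat \<Rightarrow> 'w \<Rightarrow> nat) \<Rightarrow> (nat \<Rightarrow> 'w \<Rightarrow> real ^ 'd) \<Rightarrow> bool" where
  "svrg_sampling M n T I U \<longleftrightarrow>
     prob_space.indep_vars M (\<lambda>_. count_space {1..n} \<Otimes>\<^sub>M borel) (\<lambda>t \<omega>. (I t \<omega>, U t \<omega>)) {1..T} \<and>
     (\<forall>t\<in>{1..T}.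
        prob_space.indep_set M
          (sets (vimage_algebra (space M) (I t) (count_space {1..n})))
          (sets (vimage_algebra (space M) (U t) borel)) \<and>
        distr M (count_space {1..n}) (I t) = uniform_count_measure {1..n} \<and>
        distr M borel (U t) = uniform_measure lborel (cbox (\<chi> j. -1) (\<chi> j. 1)))"

end

theory Submission
  imports Defs
begin

text \<open>
  One step moves the iterate by at most \<open>CARD('d) * \<gamma>\<close> in the \<open>l1\<close>-norm, whatever the samples
  are, and a new reference point is created only at \<open>l1\<close>-distance more than \<open>D\<close> from the old
  one. Hence \<open>D\<close> times the number of updates, plus the current distance to the reference point,
  grows by at most \<open>CARD('d) * \<gamma>\<close> per step. With the given parameters, \<open>P * (k(T) - 1) \<le> T - 1 < T\<close>,
  so that the integer \<open>k(T) - 1\<close> is smaller than the ceiling of \<open>T / P\<close>.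
\<close>

lemma l1_norm_zero [simp]: "l1_norm 0 = 0"
  by (simp add: l1_norm_def)

lemma l1_norm_triangle: "l1_norm (u + w) \<le> l1_norm u + l1_norm w"
  by (simp add: l1_norm_def sum.distrib [symmetric] sum_mono)

text \<open>Each of the \<open>CARD('d)\<close> coordinates has modulus \<open>\<gamma>\<close> or,
  where \<open>sgn\<close> vanishes, 0.\<close>

lemma l1_norm_scaled_sign_le:
  fixes w :: "real ^ 'd"
  assumes "\<gamma> \<ge> 0"
  shows "l1_norm (- (\<gamma> *\<^sub>R sign_vec w)) \<le> real CARD('d) * \<gamma>"
proof -
  have "l1_norm (- (\<gamma> *\<^sub>R sign_vec w)) \<le> (\<Sum>j\<in>(UNIV :: 'd set). \<gamma>)"
    unfolding l1_norm_def
    by (rule sum_mono) (use assms in \<open>simp add: sign_vec_def abs_mult sgn_if\<close>)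
  then show ?thesis
    by simp
qed

definition svrg_potential :: "real \<Rightarrow> (real ^ 'd) svrg_state \<Rightarrow> real" where
  "svrg_potential D s = D * real (ref_count s) + l1_norm (iterate s - ref_point s)"

text \<open>In the update case the current distance exceeds \<open>D\<close> before it is reset to 0, which pays
  for the increment of the count.\<close>

lemma svrg_step_potential:
  fixes s :: "(real ^ 'd) svrg_state"
  assumes "\<gamma> \<ge> 0"
  shows "svrg_potential D (svrg_step v n f L1 D \<gamma> i u s) \<le> svrg_potential D s + real CARD('d) * \<gamma>"
proof -
  define w where "w = gradient (f i) (iterate s) - gradient (f i) (ref_point s)
              + ref_gradient s + noise_scale v L1 s * u"
  define x' where "x' = iterate s - \<gamma> *\<^sub>R sign_vec w"
  have "x' - ref_point s = (iterate s - ref_point s) + - (\<gamma> *\<^sub>R sign_vec w)"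
    by (simp add: x'_def)
  then have "l1_norm (x' - ref_point s)
      \<le> l1_norm (iterate s - ref_point s) + real CARD('d) * \<gamma>"
    using l1_norm_triangle [of "iterate s - ref_point s"] l1_norm_scaled_sign_le [OF assms, of w]
    by (smt (verit))
  then show ?thesis
    by (simp add: svrg_potential_def svrg_step_def Let_def w_def [symmetric] x'_def [symmetric] distrib_left)
qed

text \<open>The run starts at time 1 with count 1 and distance 0, hence potential \<open>D\<close>;
  time \<open>Suc t\<close> is reached after \<open>t\<close> steps.\<close>

lemma sign_svrg_potential:
  fixes x1 :: "real ^ 'd"
  assumes "\<gamma> \<ge> 0"
  shows "svrg_potential D (sign_svrg v n f L1 D \<gamma> x1 i u (Suc t)) \<le> D + real t * (real CARD('d) * \<gamma>)"
proof (induction t)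
  case 0
  show ?case
    by (simp add: svrg_potential_def svrg_init_def)
next
  case (Suc t)
  then show ?case
    using svrg_step_potential [OF assms, of D v n f L1 "i (Suc t)" "u (Suc t)"
        "sign_svrg v n f L1 D \<gamma> x1 i u (Suc t)"]
    \<comment> \<open>Only the last step is unfolded, so that the state at \<open>Suc t\<close>
      still matches the induction hypothesis.\<close>
    unfolding sign_svrg.simps(2) [of _ _ _ _ _ _ _ _ _ "Suc t"]
    by (simp add: distrib_right del: sign_svrg.simps)
qed

theorem lemma4:
  fixes n T :: nat
    and f :: "nat \<Rightarrow> real ^ 'd \<Rightarrow> real"
    and L1 P D \<gamma> :: real
    and x1 :: "real ^ 'd"
    and v :: variant
    and M :: "'w measure"
    and I :: "nat \<Rightarrow> 'w \<Rightarrow> nat"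
    and U :: "nat \<Rightarrow> 'w \<Rightarrow> real ^ 'd"
    and \<omega> :: 'w
  assumes "n \<ge> 1" and "T \<ge> 1"
    and "\<And>i. i \<in> {1..n} \<Longrightarrow> continuously_differentiable (f i)"
    and "L1 > 0"
    and "\<And>i x y. i \<in> {1..n} \<Longrightarrow>
           infnorm (gradient (f i) x - gradient (f i) y) \<le> L1 * l1_norm (x - y)"
    and "bdd_below (range (average_fun n f))"
    and "P > 0"
    and "D = P * sqrt (2 / (L1 * real T))"
    and "\<gamma> = 1 / real CARD('d) * sqrt (2 / (L1 * real T))"
    and "prob_space M"
    and "svrg_sampling M n T I U"
    and "\<omega> \<in> space M"
  shows "int (ref_count (sign_svrg v n f L1 D \<gamma> x1 (\<lambda>t. I t \<omega>) (\<lambda>t. U t \<omega>) T)) \<le> \<lceil>real T / P\<rceil>"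
proof -
  \<comment> \<open>The common scale of \<open>D\<close> and of the step bound
    \<open>CARD('d) * \<gamma>\<close>; it cancels below.\<close>
  define \<sigma> where "\<sigma> = sqrt (2 / (L1 * real T))"
  define S where "S = sign_svrg v n f L1 D \<gamma> x1 (\<lambda>t. I t \<omega>) (\<lambda>t. U t \<omega>) T"
  have \<sigma>: "\<sigma> > 0"
    using assms(2,4) by (simp add: \<sigma>_def)
  have step: "real CARD('d) * \<gamma> = \<sigma>" and D: "D = P * \<sigma>" and \<gamma>: "\<gamma> \<ge> 0"
    using \<sigma> assms(8,9) by (simp_all add: \<sigma>_def)
  obtain t where T: "T = Suc t"
    using assms(2) by (cases T) auto
  have "D * real (ref_count S) + l1_norm (iterate S - ref_point S) \<le> D + real t * \<sigma>"
    unfolding svrg_potential_def [symmetric] S_def T step [symmetric]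
    by (rule sign_svrg_potential [OF \<gamma>])
  moreover have "l1_norm (iterate S - ref_point S) \<ge> 0"
    by (simp add: l1_norm_def sum_nonneg)
  ultimately have "\<sigma> * (P * real (ref_count S)) \<le> \<sigma> * (P + real t)"
    by (simp add: D algebra_simps)
  then have "P * real (ref_count S) \<le> P + real t"
    using \<sigma> by simp
  \<comment> \<open>Strict because \<open>t < T\<close>; with \<le> the ceiling bound would be off
    by one for integral \<open>T / P\<close>.\<close>
  then have "real (ref_count S) - 1 < real T / P"
    using assms(7) T by (simp add: field_simps)
  then show ?thesis
    unfolding S_def [symmetric] by linarith
qed

end
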